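(* Let $G$ be a group, $M=G^0=G\sqcup\{0\}$ the monoid obtained from $G$ by adjoining a zero element, and $\alpha$ a strong partial action of $M$ on a semigroup $X$. If $\operatorname{dom}\alpha_m$ and $\operatorname{im}\alpha_m$ are unital ideals of $X$ for all $m\in M$, then $\alpha$ is globalizable (in the category of semigroups) if and only if the following condition holds: (LC2') for all $g\in G$, $y\in\operatorname{dom}\alpha_g$ and $x,z\in X^1$: if $xyz\in\operatorname{dom}\alpha_0$, then $x\alpha_g(y)z\in\operatorname{dom}\alpha_0$.
   Context: Let $M$ be a monoid with identity $e$. A strong partial action of $M$ on a set $X$ is a family $\alpha=\{\alpha_m:\operatorname{dom}\alpha_m\to X\}_{m\in M}$ of maps with $\operatorname{dom}\alpha_m\subseteq X$ such that: (1) $\operatorname{dom}\alpha_e=X$ and $\alpha_e=\mathrm{id}_X$; (2) $\alpha_m^{-1}(\operatorname{dom}\alpha_n)=\operatorname{dom}\alpha_{nm}\cap\operatorname{dom}\alpha_m$ for all $m,n\in M$; (3) $\alpha_n\circ\alpha_m=\alpha_{nm}$ on $\alpha_m^{-1}(\operatorname{dom}\alpha_n)$ for all $m,n\in M$. It is a global action if $\operatorname{dom}\alpha_m=X$ for all $m$. A strong partial action (global action) of $M$ on a semigroup $X$ is one on the underlying set such that each $\operatorname{dom}\alpha_m$ is a subsemigroup of $X$ and each $\alpha_m$ is a semigroup homomorphism. Write $\operatorname{im}\alpha_m=\alpha_m(\operatorname{dom}\alpha_m)$. Ideals are two-sided; an ideal is unital if it has an identity element as a semigroup in its own right. $X^1$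 denotes the semigroup $X$ with an identity element $1$ adjoined. If $\alpha$ is a strong partial action of $M$ on a semigroup $X$ and $\beta$ is a global action of $M$ on a semigroup $Y$, a morphism $\iota:\alpha\to\beta$ is a semigroup homomorphism $\iota:X\to Y$ with $\beta_m(\iota(x))=\iota(\alpha_m(x))$ for all $m\in M$, $x\in\operatorname{dom}\alpha_m$. A globalization of $\alpha$ is a pair $(\beta,\iota)$, with $\beta$ a global action of $M$ on a semigroup and $\iota:\alpha\to\beta$ a morphism, such that for all $x,y\in X$ and $m\in M$ with $\beta_m(\iota(x))=\iota(y)$ one has $x\in\operatorname{dom}\alpha_m$ and $\alpha_m(x)=y$. $\alpha$ is globalizable if it has a globalization. *)

theory Defs
  imports "HOL-Algebra.Group"
begin

section \<open>Semigroups with explicit carriers\<close>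

text \<open>The monoid record of HOL-Algebra carries a unit field, hence a separate record.\<close>

record 'a sgrp = "'a partial_object" +
  smult :: "'a \<Rightarrow> 'a \<Rightarrow> 'a" (infixl "\<cdot>\<index>" 70)

locale sgroup =
  fixes X (structure)
  assumes smult_closed: "\<lbrakk>x \<in> carrier X; y \<in> carrier X\<rbrakk> \<Longrightarrow> x \<cdot> y \<in> carrier X"
    and smult_assoc: "\<lbrakk>x \<in> carrier X; y \<in> carrier X; z \<in> carrier X\<rbrakk>
      \<Longrightarrow> (x \<cdot> y) \<cdot> z = x \<cdot> (y \<cdot> z)"

definition subsemigroup :: "'x set \<Rightarrow> ('x, 'c) sgrp_scheme \<Rightarrow> bool" where
  "subsemigroup A X \<longleftrightarrow> A \<subseteq> carrier X \<and> (\<forall>x\<in>A. \<forall>y\<in>A. x \<cdot>\<^bsub>X\<^esub> y \<in> A)"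

definition sg_hom :: "('x, 'c) sgrp_scheme \<Rightarrow> ('y, 'd) sgrp_scheme \<Rightarrow> ('x \<Rightarrow> 'y) set" where
  "sg_hom X Y = {f. (\<forall>x\<in>carrier X. f x \<in> carrier Y) \<and>
     (\<forall>x\<in>carrier X. \<forall>y\<in>carrier X. f (x \<cdot>\<^bsub>X\<^esub> y) = f x \<cdot>\<^bsub>Y\<^esub> f y)}"

definition sg_ideal :: "'x set \<Rightarrow> ('x, 'c) sgrp_scheme \<Rightarrow> bool" where
  "sg_ideal I X \<longleftrightarrow> I \<subseteq> carrier X \<and>
     (\<forall>a\<in>I. \<forall>x\<in>carrier X. x \<cdot>\<^bsub>X\<^esub> a \<in> I \<and> a \<cdot>\<^bsub>X\<^esub> x \<in> I)"

definition unital_ideal :: "'x set \<Rightarrow> ('x, 'c) sgrp_scheme \<Rightarrow> bool" where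
  "unital_ideal I X \<longleftrightarrow> sg_ideal I X \<and>
     (\<exists>u\<in>I. \<forall>a\<in>I. u \<cdot>\<^bsub>X\<^esub> a = a \<and> a \<cdot>\<^bsub>X\<^esub> u = a)"

text \<open>\<open>X\<^sup>1\<close>: a new identity is adjoined even if \<open>X\<close> already has one.\<close>

datatype 'x with_one = One | In 'x

fun mult_with_one :: "('x \<Rightarrow> 'x \<Rightarrow> 'x) \<Rightarrow> 'x with_one \<Rightarrow> 'x with_one \<Rightarrow> 'x with_one" where
  "mult_with_one f One b = b"
| "mult_with_one f (In x) One = In x"
| "mult_with_one f (In x) (In y) = In (f x y)"

definition adjoin_one :: "('x, 'c) sgrp_scheme \<Rightarrow> 'x with_one sgrp" where
  "adjoin_one X = \<lparr>carrier = insert One (In ` carrier X), smult = mult_with_one (smult X)\<rparr>"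

section \<open>The monoid \<open>G\<^sup>0\<close>\<close>

datatype 'g with_zero = Zero | Nz 'g

fun mult_with_zero :: "('g \<Rightarrow> 'g \<Rightarrow> 'g) \<Rightarrow> 'g with_zero \<Rightarrow> 'g with_zero \<Rightarrow> 'g with_zero" where
  "mult_with_zero f (Nz x) (Nz y) = Nz (f x y)"
| "mult_with_zero f _ _ = Zero"

definition adjoin_zero :: "('g, 'c) monoid_scheme \<Rightarrow> 'g with_zero monoid" where
  "adjoin_zero G = \<lparr>carrier = insert Zero (Nz ` carrier G),
     mult = mult_with_zero (mult G), one = Nz (one G)\<rparr>"

lemma monoid_adjoin_zero:
  assumes "monoid G"
  shows "monoid (adjoin_zero G)"
proof -
  interpret monoid G by fact
  show ?thesis
    by unfold_locales (auto simp: adjoin_zero_def m_assoc)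
qed

section \<open>Strong partial actions and globalizations\<close>

text \<open>The partial map \<open>\<alpha>\<^sub>m\<close> is \<open>\<alpha> m :: 'x \<rightharpoonup> 'x\<close>, so that \<open>dom (\<alpha> m)\<close> and \<open>ran (\<alpha> m)\<close>
  are its domain and image, and \<open>the (\<alpha> m x)\<close> is its value at a point \<open>x\<close> of the domain.
  Nothing is required of \<open>\<alpha> m\<close> for \<open>m \<notin> carrier M\<close>.\<close>

definition pre_image :: "('x \<rightharpoonup> 'x) \<Rightarrow> 'x set \<Rightarrow> 'x set" where
  "pre_image f A = {x \<in> dom f. the (f x) \<in> A}"

locale strong_partial_action_set = monoid M
  for M (structure) and S :: "'x set" and \<alpha> :: "'m \<Rightarrow> 'x \<rightharpoonup> 'x" +
  assumes dom_subset: "m \<in> carrier M \<Longrightarrow> dom (\<alpha> m) \<subseteq> S"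
    and ran_subset: "m \<in> carrier M \<Longrightarrow> ran (\<alpha> m) \<subseteq> S"
    and dom_one: "dom (\<alpha> \<one>) = S"
    and act_one: "x \<in> S \<Longrightarrow> the (\<alpha> \<one> x) = x"
    and dom_mult: "\<lbrakk>m \<in> carrier M; n \<in> carrier M\<rbrakk> \<Longrightarrow>
      pre_image (\<alpha> m) (dom (\<alpha> n)) = dom (\<alpha> (n \<otimes> m)) \<inter> dom (\<alpha> m)"
    and act_mult: "\<lbrakk>m \<in> carrier M; n \<in> carrier M; x \<in> pre_image (\<alpha> m) (dom (\<alpha> n))\<rbrakk> \<Longrightarrow>
      the (\<alpha> n (the (\<alpha> m x))) = the (\<alpha> (n \<otimes> m) x)"

locale strong_partial_action =
  strong_partial_action_set M "carrier X" \<alpha> + X: sgroup X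
  for M :: "('m, 'c) monoid_scheme" (structure)
    and X :: "('x, 'd) sgrp_scheme"
    and \<alpha> :: "'m \<Rightarrow> 'x \<rightharpoonup> 'x" +
  assumes dom_subsemigroup: "m \<in> carrier M \<Longrightarrow> subsemigroup (dom (\<alpha> m)) X"
    and act_hom: "\<lbrakk>m \<in> carrier M; x \<in> dom (\<alpha> m); y \<in> dom (\<alpha> m)\<rbrakk> \<Longrightarrow>
      the (\<alpha> m (x \<cdot>\<^bsub>X\<^esub> y)) = the (\<alpha> m x) \<cdot>\<^bsub>X\<^esub> the (\<alpha> m y)"

locale global_action = strong_partial_action M Y \<beta>
  for M :: "('m, 'c) monoid_scheme" (structure)
    and Y :: "('y, 'd) sgrp_scheme"
    and \<beta> :: "'m \<Rightarrow> 'y \<rightharpoonup> 'y" +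
  assumes dom_global: "m \<in> carrier M \<Longrightarrow> dom (\<beta> m) = carrier Y"

definition action_morphism ::
    "('m, 'c) monoid_scheme \<Rightarrow> ('x, 'd) sgrp_scheme \<Rightarrow> ('m \<Rightarrow> 'x \<rightharpoonup> 'x) \<Rightarrow>
     ('y, 'e) sgrp_scheme \<Rightarrow> ('m \<Rightarrow> 'y \<rightharpoonup> 'y) \<Rightarrow> ('x \<Rightarrow> 'y) \<Rightarrow> bool" where
  "action_morphism M X \<alpha> Y \<beta> \<iota> \<longleftrightarrow> \<iota> \<in> sg_hom X Y \<and>
     (\<forall>m\<in>carrier M. \<forall>x\<in>dom (\<alpha> m). the (\<beta> m (\<iota> x)) = \<iota> (the (\<alpha> m x)))"

definition is_globalization ::
    "('m, 'c) monoid_scheme \<Rightarrow> ('x, 'd) sgrp_scheme \<Rightarrow> ('m \<Rightarrow> 'x \<rightharpoonup> 'x) \<Rightarrow>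
     ('y, 'e) sgrp_scheme \<Rightarrow> ('m \<Rightarrow> 'y \<rightharpoonup> 'y) \<Rightarrow> ('x \<Rightarrow> 'y) \<Rightarrow> bool" where
  "is_globalization M X \<alpha> Y \<beta> \<iota> \<longleftrightarrow>
     global_action M Y \<beta> \<and> action_morphism M X \<alpha> Y \<beta> \<iota> \<and>
     (\<forall>x\<in>carrier X. \<forall>y\<in>carrier X. \<forall>m\<in>carrier M.
        the (\<beta> m (\<iota> x)) = \<iota> y \<longrightarrow> x \<in> dom (\<alpha> m) \<and> the (\<alpha> m x) = y)"

text \<open>HOL cannot quantify existentially over all semigroups of all types, so the semigroup is
  sought among those whose carrier is a subset of the type of words over \<open>'m \<times> 'x\<close>. This loses
  nothing: by lemma \<open>globalizableI\<close> below, a globalization on any type whatsoever yields one of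
  this kind, because the subsemigroup generated by the elements \<open>\<beta>\<^sub>m(\<iota>(x))\<close> is an image of a
  set of such words.\<close>

definition globalizable ::
    "('m, 'c) monoid_scheme \<Rightarrow> ('x, 'd) sgrp_scheme \<Rightarrow> ('m \<Rightarrow> 'x \<rightharpoonup> 'x) \<Rightarrow> bool" where
  "globalizable M X \<alpha> \<longleftrightarrow>
     (\<exists>(Y :: ('m \<times> 'x) list sgrp) \<beta> \<iota>. is_globalization M X \<alpha> Y \<beta> \<iota>)"

definition LC2' ::
    "('g, 'c) monoid_scheme \<Rightarrow> ('x, 'd) sgrp_scheme \<Rightarrow> ('g with_zero \<Rightarrow> 'x \<rightharpoonup> 'x) \<Rightarrow> bool" where
  "LC2' G X \<alpha> \<longleftrightarrow>
     (\<forall>g\<in>carrier G. \<forall>y\<in>dom (\<alpha> (Nz g)).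
       \<forall>x\<in>carrier (adjoin_one X). \<forall>z\<in>carrier (adjoin_one X).
         x \<cdot>\<^bsub>adjoin_one X\<^esub> In y \<cdot>\<^bsub>adjoin_one X\<^esub> z \<in> In ` dom (\<alpha> Zero) \<longrightarrow>
         x \<cdot>\<^bsub>adjoin_one X\<^esub> In (the (\<alpha> (Nz g) y)) \<cdot>\<^bsub>adjoin_one X\<^esub> z \<in> In ` dom (\<alpha> Zero))"

section \<open>Independence of the type of the globalization\<close>

lemma (in global_action) global_act:
  assumes "m \<in> carrier M" "y \<in> carrier Y"
  shows "the (\<beta> m y) \<in> carrier Y" "\<beta> m y = Some (the (\<beta> m y))"
proof -
  show *: "\<beta> m y = Some (the (\<beta> m y))"
    using dom_global[OF assms(1)] assms(2) by (metis domD option.sel)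
  show "the (\<beta> m y) \<in> carrier Y"
    using ran_subset[OF assms(1)] * by (meson ranI subsetD)
qed

lemma (in global_action) global_act_mult:
  assumes "m \<in> carrier M" "n \<in> carrier M" "y \<in> carrier Y"
  shows "the (\<beta> n (the (\<beta> m y))) = the (\<beta> (n \<otimes> m) y)"
  using assms by (intro act_mult) (auto simp: pre_image_def dom_global global_act(1))

lemma globalization_transport:
  fixes M :: "('m, 'c) monoid_scheme" and Y :: "('y, 'e) sgrp_scheme" and r :: "'y \<Rightarrow> 'z"
  assumes glob: "is_globalization M X \<alpha> Y \<beta> \<iota>"
    and S: "subsemigroup S Y"
    and S_act: "\<And>m y. \<lbrakk>m \<in> carrier M; y \<in> S\<rbrakk> \<Longrightarrow> the (\<beta> m y) \<in> S"
    and S_\<iota>: "\<And>x. x \<in> carrier X \<Longrightarrow> \<iota> x \<in> S"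
    and dom_X: "\<And>m. m \<in> carrier M \<Longrightarrow> dom (\<alpha> m) \<subseteq> carrier X"
    and ran_X: "\<And>m. m \<in> carrier M \<Longrightarrow> ran (\<alpha> m) \<subseteq> carrier X"
    and inj: "inj_on r S"
    and closed_X: "\<And>x y. \<lbrakk>x \<in> carrier X; y \<in> carrier X\<rbrakk> \<Longrightarrow> x \<cdot>\<^bsub>X\<^esub> y \<in> carrier X"
  shows "\<exists>(Z :: 'z sgrp) \<gamma> \<kappa>. is_globalization M X \<alpha> Z \<gamma> \<kappa>"
proof -
  interpret global_action M Y \<beta> using glob by (simp add: is_globalization_def)
  define e where "e = the_inv_into S r"
  have e: "e (r y) = y" if "y \<in> S" for y
    using that inj by (simp add: e_def the_inv_into_f_f)
  have r_eq: "r y = r y' \<longleftrightarrow> y = y'" if "y \<in> S" "y' \<in> S" for y y'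
    using that inj by (auto dest: inj_onD)
  have SY: "y \<in> carrier Y" if "y \<in> S" for y
    using that S by (auto simp: subsemigroup_def)
  have S_mult: "y \<cdot>\<^bsub>Y\<^esub> y' \<in> S" if "y \<in> S" "y' \<in> S" for y y'
    using that S by (auto simp: subsemigroup_def)
  define Z where "Z = \<lparr>carrier = r ` S, smult = \<lambda>a b. r (e a \<cdot>\<^bsub>Y\<^esub> e b)\<rparr>"
  define \<gamma> where "\<gamma> = (\<lambda>m a. if a \<in> r ` S then Some (r (the (\<beta> m (e a)))) else None)"
  define \<kappa> where "\<kappa> = (\<lambda>x. r (\<iota> x))"
  have carrier_Z: "carrier Z = r ` S" by (simp add: Z_def)
  have mult_Z: "r y \<cdot>\<^bsub>Z\<^esub> r y' = r (y \<cdot>\<^bsub>Y\<^esub> y')" if "y \<in> S" "y' \<in> S" for y y'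
    using that by (simp add: Z_def e)
  have \<gamma>: "\<gamma> m (r y) = Some (r (the (\<beta> m y)))" if "y \<in> S" for m y
    using that by (auto simp: \<gamma>_def e)
  have dom_\<gamma>: "dom (\<gamma> m) = r ` S" for m
    by (auto simp: \<gamma>_def split: if_splits)
  have ran_\<gamma>: "ran (\<gamma> m) \<subseteq> r ` S" if "m \<in> carrier M" for m
    using that by (auto simp: \<gamma>_def ran_def e intro!: imageI S_act split: if_splits)
  have "global_action M Z \<gamma>"
  proof
    fix x y z assume "x \<in> carrier Z" "y \<in> carrier Z" "z \<in> carrier Z"
    then show "x \<cdot>\<^bsub>Z\<^esub> y \<cdot>\<^bsub>Z\<^esub> z = x \<cdot>\<^bsub>Z\<^esub> (y \<cdot>\<^bsub>Z\<^esub> z)"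
      by (auto simp: carrier_Z mult_Z S_mult X.smult_assoc SY)
  next
    fix x y assume "x \<in> carrier Z" "y \<in> carrier Z"
    then show "x \<cdot>\<^bsub>Z\<^esub> y \<in> carrier Z"
      by (auto simp: carrier_Z mult_Z S_mult)
  next
    fix x assume "x \<in> carrier Z"
    then show "the (\<gamma> \<one>\<^bsub>M\<^esub> x) = x"
      by (auto simp: carrier_Z \<gamma> act_one SY)
  next
    fix m n assume mn: "m \<in> carrier M" "n \<in> carrier M"
    show "pre_image (\<gamma> m) (dom (\<gamma> n)) = dom (\<gamma> (n \<otimes>\<^bsub>M\<^esub> m)) \<inter> dom (\<gamma> m)"
      using mn by (auto simp: pre_image_def dom_\<gamma> \<gamma> S_act)
    fix x assume "x \<in> pre_image (\<gamma> m) (dom (\<gamma> n))"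
    then show "the (\<gamma> n (the (\<gamma> m x))) = the (\<gamma> (n \<otimes>\<^bsub>M\<^esub> m) x)"
      using mn by (auto simp: dom_\<gamma> pre_image_def \<gamma> S_act r_eq SY simp flip: global_act_mult)
  next
    fix m assume m: "m \<in> carrier M"
    show "subsemigroup (dom (\<gamma> m)) Z"
      by (auto simp: subsemigroup_def dom_\<gamma> carrier_Z mult_Z S_mult)
    fix x y assume "x \<in> dom (\<gamma> m)" "y \<in> dom (\<gamma> m)"
    then show "the (\<gamma> m (x \<cdot>\<^bsub>Z\<^esub> y)) = the (\<gamma> m x) \<cdot>\<^bsub>Z\<^esub> the (\<gamma> m y)"
      using m by (auto simp: dom_\<gamma> mult_Z \<gamma> S_mult S_act act_hom dom_global SY)
  qed (use ran_\<gamma> in \<open>auto simp: carrier_Z dom_\<gamma>\<close>)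
  moreover have "action_morphism M X \<alpha> Z \<gamma> \<kappa>"
  proof -
    have \<iota>: "\<iota> \<in> sg_hom X Y"
      "\<And>m x. \<lbrakk>m \<in> carrier M; x \<in> dom (\<alpha> m)\<rbrakk> \<Longrightarrow> the (\<beta> m (\<iota> x)) = \<iota> (the (\<alpha> m x))"
      using glob by (auto simp: is_globalization_def action_morphism_def)
    have "\<kappa> \<in> sg_hom X Z"
      using \<iota>(1) by (auto simp: sg_hom_def \<kappa>_def carrier_Z mult_Z S_\<iota>)
    moreover have "the (\<gamma> m (\<kappa> x)) = \<kappa> (the (\<alpha> m x))"
      if "m \<in> carrier M" "x \<in> dom (\<alpha> m)" for m x
      using that dom_X[OF that(1)] \<iota>(2)[OF that] by (auto simp: \<kappa>_def \<gamma> S_\<iota> subset_iff)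
    ultimately show ?thesis by (auto simp: action_morphism_def)
  qed
  moreover have "x \<in> dom (\<alpha> m) \<and> the (\<alpha> m x) = y"
    if "x \<in> carrier X" "y \<in> carrier X" "m \<in> carrier M" "the (\<gamma> m (\<kappa> x)) = \<kappa> y" for x y m
  proof -
    have "the (\<beta> m (\<iota> x)) = \<iota> y"
      using that by (simp add: \<kappa>_def \<gamma> S_\<iota> r_eq S_act)
    then show ?thesis using that glob by (auto simp: is_globalization_def)
  qed
  ultimately have "is_globalization M X \<alpha> Z \<gamma> \<kappa>"
    by (auto simp: is_globalization_def)
  then show ?thesis by blast
qed

fun word_val :: "('y, 'e) sgrp_scheme \<Rightarrow> ('m \<Rightarrow> 'y \<rightharpoonup> 'y) \<Rightarrow> ('x \<Rightarrow> 'y) \<Rightarrow> ('m \<times> 'x) list \<Rightarrow> 'y" where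
  "word_val Y \<beta> \<iota> [] = undefined"
| "word_val Y \<beta> \<iota> [p] = the (\<beta> (fst p) (\<iota> (snd p)))"
| "word_val Y \<beta> \<iota> (p # q # w) = the (\<beta> (fst p) (\<iota> (snd p))) \<cdot>\<^bsub>Y\<^esub> word_val Y \<beta> \<iota> (q # w)"

theorem globalizableI:
  assumes act: "strong_partial_action M X \<alpha>"
    and glob: "is_globalization M X \<alpha> Y \<beta> \<iota>"
  shows "globalizable M X \<alpha>"
proof -
  interpret A: strong_partial_action M X \<alpha> by fact
  interpret global_action M Y \<beta> using glob by (simp add: is_globalization_def)
  have \<iota>: "\<iota> x \<in> carrier Y" if "x \<in> carrier X" for x
    using glob that by (auto simp: is_globalization_def action_morphism_def sg_hom_def)
  let ?v = "word_val Y \<beta> \<iota>"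
  define W where "W = {w. w \<noteq> [] \<and> set w \<subseteq> carrier M \<times> carrier X}"
  have v_carrier: "w \<in> W \<Longrightarrow> ?v w \<in> carrier Y" for w
    by (induction w rule: induct_list012)
      (auto simp: W_def intro!: X.smult_closed global_act(1) \<iota>)
  have v_Cons: "?v (p # w) = the (\<beta> (fst p) (\<iota> (snd p))) \<cdot>\<^bsub>Y\<^esub> ?v w" if "w \<noteq> []" for p w
    using that by (cases w) auto
  have v_append: "u \<in> W \<Longrightarrow> w \<in> W \<Longrightarrow> ?v (u @ w) = ?v u \<cdot>\<^bsub>Y\<^esub> ?v w" for u w
  proof (induction u)
    case (Cons p u)
    show ?case
    proof (cases "u = []")
      case True
      then show ?thesis using Cons.prems by (simp add: v_Cons W_def)
    next
      case False
      with Cons.prems have u: "u \<in> W" and p: "fst p \<in> carrier M" "snd p \<in> carrier X"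
        by (auto simp: W_def)
      show ?thesis
        using False Cons.IH[OF u Cons.prems(2)] u p Cons.prems(2)
        by (simp add: v_Cons X.smult_assoc global_act(1) \<iota> v_carrier)
    qed
  qed (simp add: W_def)
  have v_act: "m \<in> carrier M \<Longrightarrow> w \<in> W \<Longrightarrow>
      the (\<beta> m (?v w)) = ?v (map (\<lambda>p. (m \<otimes>\<^bsub>M\<^esub> fst p, snd p)) w)" for m w
  proof (induction w)
    case (Cons p u)
    have p: "fst p \<in> carrier M" "snd p \<in> carrier X" using Cons.prems by (auto simp: W_def)
    show ?case
    proof (cases "u = []")
      case True
      then show ?thesis using Cons.prems p by (simp add: global_act_mult \<iota>)
    next
      case False
      with Cons.prems have u: "u \<in> W" by (auto simp: W_def)
      show ?thesis
        using False Cons.IH[OF Cons.prems(1) u] Cons.prems(1) u p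
        by (simp add: v_Cons act_hom dom_global global_act(1) \<iota> v_carrier global_act_mult)
    qed
  qed (simp add: W_def)
  have W_append: "u @ w \<in> W" if "u \<in> W" "w \<in> W" for u w
    using that by (auto simp: W_def)
  have W_act: "map (\<lambda>p. (m \<otimes>\<^bsub>M\<^esub> fst p, snd p)) w \<in> W" if "m \<in> carrier M" "w \<in> W" for m w
    using that by (auto simp: W_def)
  have "\<exists>(Z :: ('a \<times> 'c) list sgrp) \<gamma> \<kappa>. is_globalization M X \<alpha> Z \<gamma> \<kappa>"
  proof (rule globalization_transport[OF glob, where S = "?v ` W" and r = "inv_into W ?v"])
    show "subsemigroup (?v ` W) Y"
      by (auto simp: subsemigroup_def v_carrier v_append[symmetric] intro!: imageI W_append)
    show "the (\<beta> m y) \<in> ?v ` W" if "m \<in> carrier M" "y \<in> ?v ` W" for m y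
      using that by (auto simp: v_act intro!: imageI W_act)
    show "\<iota> x \<in> ?v ` W" if "x \<in> carrier X" for x
      using that by (intro image_eqI[of _ _ "[(\<one>\<^bsub>M\<^esub>, x)]"]) (auto simp: W_def act_one \<iota>)
    show "inj_on (inv_into W ?v) (?v ` W)"
      by (simp add: inj_on_inv_into)
  qed (use A.dom_subset A.ran_subset A.X.smult_closed in auto)
  then show ?thesis by (simp add: globalizable_def)
qed

end

theory Submission
  imports Defs
begin

text \<open>Since \<open>dom \<alpha>\<^sub>e = X\<close> is unital, \<open>X\<close> is a monoid, and each \<open>dom \<alpha>\<^sub>m\<close> is \<open>e\<^sub>mX\<close> for a central
  idempotent \<open>e\<^sub>m\<close>. With \<open>r = \<alpha>\<^sub>0(e\<^sub>0)\<close>, the map \<open>\<alpha>\<^sub>0\<close> is multiplication by the central idempotent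
  \<open>r\<close>, and every \<open>\<alpha>\<^sub>g\<close> fixes \<open>rX\<close> pointwise. Let \<open>x \<sim> y\<close> mean that \<open>xr = yr\<close> and that \<open>x\<close>, \<open>y\<close> are
  equivalent in the syntactic congruence of \<open>dom \<alpha>\<^sub>0\<close>; (LC2') says precisely that \<open>\<alpha>\<^sub>g(y) \<sim> y\<close> always
  holds. Then \<open>G\<^sup>0\<close> acts on \<open>X\<^sup>G \<times> X/\<sim>\<close> by \<open>\<beta>\<^sub>h(f, c) = (f(_ h), c)\<close> and \<open>\<beta>\<^sub>0(f, c) = (const (cr), c)\<close>,
  and \<open>\<iota>(x) = (g \<mapsto> \<alpha>\<^sub>g(x e\<^sub>g), [x])\<close> is a globalization: the first component takes care of the group
  part, and the second one detects membership in \<open>dom \<alpha>\<^sub>0\<close>. Conversely, \<open>\<beta>\<^sub>0\<beta>\<^sub>g = \<beta>\<^sub>0\<close> forces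
  \<open>\<beta>\<^sub>0\<iota>\<close> to identify \<open>xyz\<close> with \<open>x\<alpha>\<^sub>g(y)z\<close>, and \<open>\<beta>\<^sub>0\<iota>\<close> maps only \<open>dom \<alpha>\<^sub>0\<close> into \<open>\<iota>(X)\<close>.\<close>

section \<open>Central identities of unital ideals\<close>

text \<open>Both \<open>u \<cdot> x\<close> and \<open>x \<cdot> u\<close> lie in \<open>I\<close>,
  so each absorbs a further \<open>u\<close> on its other side, and associativity equates
  them.\<close>

lemma (in sgroup) unital_ideal_central_unit:
  assumes "unital_ideal I X"
  obtains u where "u \<in> I" "\<And>x. x \<in> carrier X \<Longrightarrow> u \<cdot> x = x \<cdot> u" "\<And>a. a \<in> I \<Longrightarrow> a \<cdot> u = a"
proof -
  from assms obtain u where u: "u \<in> I" "\<And>a. a \<in> I \<Longrightarrow> u \<cdot> a = a" "\<And>a. a \<in> I \<Longrightarrow> a \<cdot> u = a"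
    by (auto simp: unital_ideal_def)
  have I: "I \<subseteq> carrier X" "\<And>a x. a \<in> I \<Longrightarrow> x \<in> carrier X \<Longrightarrow> x \<cdot> a \<in> I"
    "\<And>a x. a \<in> I \<Longrightarrow> x \<in> carrier X \<Longrightarrow> a \<cdot> x \<in> I"
    using assms by (auto simp: unital_ideal_def sg_ideal_def)
  have "u \<cdot> x = x \<cdot> u" if x: "x \<in> carrier X" for x
  proof -
    have "u \<cdot> x = (u \<cdot> x) \<cdot> u" using u I x by metis
    also have "\<dots> = u \<cdot> (x \<cdot> u)" using u I x by (intro smult_assoc) auto
    also have "\<dots> = x \<cdot> u" using u I x by metis
    finally show ?thesis .
  qed
  with u show thesis using that by metis
qed

locale unital_g0_action = strong_partial_action "adjoin_zero G" X \<alpha> + G: group G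
  for X :: "('x, 'd) sgrp_scheme" (structure)
    and G :: "('g, 'c) monoid_scheme"
    and \<alpha> :: "'g with_zero \<Rightarrow> 'x \<rightharpoonup> 'x" +
  assumes dom_unital: "m \<in> carrier (adjoin_zero G) \<Longrightarrow> unital_ideal (dom (\<alpha> m)) X"
    and ran_Zero_ideal: "sg_ideal (ran (\<alpha> Zero)) X"
begin

abbreviation "M \<equiv> adjoin_zero G"
abbreviation D where "D m \<equiv> dom (\<alpha> m)"

definition act where "act m x = the (\<alpha> m x)"

definition unit where
  "unit m = (SOME u. u \<in> D m \<and> (\<forall>x\<in>carrier X. u \<cdot> x = x \<cdot> u) \<and> (\<forall>a\<in>D m. a \<cdot> u = a))"

lemma carrier_M: "carrier M = insert Zero (Nz ` carrier G)"
  and mult_M [simp]: "Nz g \<otimes>\<^bsub>M\<^esub> Nz h = Nz (g \<otimes>\<^bsub>G\<^esub> h)" "Zero \<otimes>\<^bsub>M\<^esub> m = Zero" "m \<otimes>\<^bsub>M\<^esub> Zero = Zero"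
  and one_M: "\<one>\<^bsub>M\<^esub> = Nz \<one>\<^bsub>G\<^esub>"
  by (auto simp: adjoin_zero_def)

lemma M_simps [simp]: "Zero \<in> carrier M" "Nz g \<in> carrier M \<longleftrightarrow> g \<in> carrier G"
  by (auto simp: carrier_M)

lemma dom_carrier: "m \<in> carrier M \<Longrightarrow> x \<in> D m \<Longrightarrow> x \<in> carrier X"
  using dom_subset by blast

lemma act_ran: "x \<in> D m \<Longrightarrow> act m x \<in> ran (\<alpha> m)"
  by (auto simp: act_def ran_def)

lemma ran_act: "y \<in> ran (\<alpha> m) \<Longrightarrow> \<exists>x\<in>D m. y = act m x"
  by (force simp: act_def ran_def)

lemma act_closed: "m \<in> carrier M \<Longrightarrow> x \<in> D m \<Longrightarrow> act m x \<in> carrier X"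
  using act_ran ran_subset by blast

lemma act_dom_iff:
  "\<lbrakk>m \<in> carrier M; n \<in> carrier M; x \<in> D m\<rbrakk> \<Longrightarrow> act m x \<in> D n \<longleftrightarrow> x \<in> D (n \<otimes>\<^bsub>M\<^esub> m)"
  using dom_mult[of m n] by (auto simp: pre_image_def act_def)

lemma act_act:
  "\<lbrakk>m \<in> carrier M; n \<in> carrier M; x \<in> D m; x \<in> D (n \<otimes>\<^bsub>M\<^esub> m)\<rbrakk> \<Longrightarrow>
    act n (act m x) = act (n \<otimes>\<^bsub>M\<^esub> m) x"
  using act_mult[of m n x] dom_mult[of m n] by (auto simp: act_def)

lemma act_smult:
  "\<lbrakk>m \<in> carrier M; x \<in> D m; y \<in> D m\<rbrakk> \<Longrightarrow> act m (x \<cdot> y) = act m x \<cdot> act m y"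
  unfolding act_def by (rule act_hom)

lemma dom_Nz_one: "D (Nz \<one>\<^bsub>G\<^esub>) = carrier X"
  using dom_one by (simp add: one_M)

lemma act_Nz_one: "x \<in> carrier X \<Longrightarrow> act (Nz \<one>\<^bsub>G\<^esub>) x = x"
  using act_one by (simp add: one_M act_def)

lemma dom_smult:
  assumes "m \<in> carrier M" "a \<in> D m" "x \<in> carrier X"
  shows "a \<cdot> x \<in> D m" "x \<cdot> a \<in> D m"
  using dom_unital[OF assms(1)] assms by (auto simp: unital_ideal_def sg_ideal_def)

lemma unit_aux:
  assumes "m \<in> carrier M"
  shows "unit m \<in> D m \<and> (\<forall>x\<in>carrier X. unit m \<cdot> x = x \<cdot> unit m) \<and> (\<forall>a\<in>D m. a \<cdot> unit m = a)"
proof -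
  obtain u where "u \<in> D m \<and> (\<forall>x\<in>carrier X. u \<cdot> x = x \<cdot> u) \<and> (\<forall>a\<in>D m. a \<cdot> u = a)"
    using X.unital_ideal_central_unit[OF dom_unital[OF assms]] by metis
  then show ?thesis unfolding unit_def by (rule someI)
qed

lemma unit_dom: "m \<in> carrier M \<Longrightarrow> unit m \<in> D m"
  and unit_central: "\<lbrakk>m \<in> carrier M; x \<in> carrier X\<rbrakk> \<Longrightarrow> unit m \<cdot> x = x \<cdot> unit m"
  and smult_unit: "\<lbrakk>m \<in> carrier M; a \<in> D m\<rbrakk> \<Longrightarrow> a \<cdot> unit m = a"
  using unit_aux by auto

lemma unit_closed: "m \<in> carrier M \<Longrightarrow> unit m \<in> carrier X"
  using unit_dom dom_carrier by blast

lemma smult_unit_dom: "\<lbrakk>m \<in> carrier M; x \<in> carrier X\<rbrakk> \<Longrightarrow> x \<cdot> unit m \<in> D m"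
  by (simp add: dom_smult unit_dom)

text \<open>Multiplication by \<open>unit m\<close> retracts \<open>X\<close> onto
  \<open>D m\<close>. Being a homomorphism, it lets \<open>act m\<close> extend multiplicatively to
  all of \<open>X\<close>, as \<open>orbit\<close> requires.\<close>

lemma smult_unit_hom:
  assumes "m \<in> carrier M" "x \<in> carrier X" "y \<in> carrier X"
  shows "(x \<cdot> y) \<cdot> unit m = (x \<cdot> unit m) \<cdot> (y \<cdot> unit m)"
proof -
  note [simp] = assms X.smult_closed unit_closed
  have "(x \<cdot> unit m) \<cdot> (y \<cdot> unit m) = x \<cdot> ((unit m \<cdot> y) \<cdot> unit m)"
    by (simp add: X.smult_assoc)
  also have "\<dots> = x \<cdot> ((y \<cdot> unit m) \<cdot> unit m)" by (simp add: unit_central)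
  also have "(y \<cdot> unit m) \<cdot> unit m = y \<cdot> unit m" by (simp add: smult_unit smult_unit_dom)
  finally show ?thesis by (simp add: X.smult_assoc)
qed

section \<open>The map \<open>\<alpha>\<^sub>0\<close> and the identity \<open>r\<close> of its
  image\<close>

definition r where "r = act Zero (unit Zero)"

lemma act_Zero_dom: "x \<in> D Zero \<Longrightarrow> n \<in> carrier M \<Longrightarrow> act Zero x \<in> D n"
  by (simp add: act_dom_iff)

text \<open>Since n0 = 0, following \<open>\<alpha>\<^sub>0\<close> by
  \<open>\<alpha>\<^sub>n\<close> gives \<open>\<alpha>\<^sub>0\<close> again. The case n = 0 shows
  that the image of \<open>\<alpha>\<^sub>0\<close> lies in \<open>D Zero\<close>.\<close>

lemma act_fixes_ran_Zero:
  assumes "n \<in> carrier M" "a \<in> ran (\<alpha> Zero)"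
  shows "a \<in> D n" "act n a = a"
proof -
  obtain x where "x \<in> D Zero" "a = act Zero x" using ran_act assms by blast
  with assms(1) show "a \<in> D n" "act n a = a" by (simp_all add: act_Zero_dom act_act)
qed

lemma r_ran: "r \<in> ran (\<alpha> Zero)"
  by (simp add: r_def act_ran unit_dom)

lemma r_closed [simp]: "r \<in> carrier X"
  using r_ran ran_Zero_ideal by (auto simp: sg_ideal_def)

lemma smult_r_ran: "x \<in> carrier X \<Longrightarrow> x \<cdot> r \<in> ran (\<alpha> Zero)"
  using r_ran ran_Zero_ideal by (auto simp: sg_ideal_def)

lemma ran_Zero_smult_r:
  assumes "a \<in> ran (\<alpha> Zero)"
  shows "a \<cdot> r = a" "r \<cdot> a = a"
proof -
  obtain x where x: "x \<in> D Zero" "a = act Zero x" using ran_act assms by blast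
  then have "x \<in> carrier X" using dom_carrier[of Zero x] by simp
  then have "unit Zero \<cdot> x = x" using x by (simp add: unit_central smult_unit)
  with x show "a \<cdot> r = a" "r \<cdot> a = a"
    by (simp_all add: r_def unit_dom smult_unit flip: act_smult)
qed

lemma smult_r_hom:
  assumes "x \<in> carrier X" "y \<in> carrier X"
  shows "(x \<cdot> y) \<cdot> r = (x \<cdot> r) \<cdot> (y \<cdot> r)"
  by (metis X.smult_assoc X.smult_closed assms r_closed ran_Zero_smult_r(2) smult_r_ran)

text \<open>As \<open>x \<cdot> r\<close> lies in the image of \<open>\<alpha>\<^sub>0\<close>, it
  is fixed by \<open>\<alpha>\<^sub>0\<close>; multiplicativity turns it into
  \<open>act Zero x \<cdot> r\<close>, where \<open>r\<close> is absorbed.\<close>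

lemma act_Zero_eq:
  assumes "x \<in> D Zero"
  shows "act Zero x = x \<cdot> r"
proof -
  have x: "x \<in> carrier X" using assms dom_carrier[of Zero x] by simp
  have "x \<cdot> r = act Zero (x \<cdot> r)" using smult_r_ran act_fixes_ran_Zero x by simp
  also have "\<dots> = act Zero x \<cdot> r"
    using assms r_ran by (simp add: act_smult act_fixes_ran_Zero)
  also have "\<dots> = act Zero x" using assms by (simp add: act_ran ran_Zero_smult_r)
  finally show ?thesis by simp
qed

text \<open>The same argument; it supplies the first clause of
  \<open>act m x \<sim> x\<close>.\<close>

lemma act_smult_r:
  assumes "m \<in> carrier M" "x \<in> D m"
  shows "act m x \<cdot> r = x \<cdot> r"
proof -
  have "act m x \<cdot> r = act m (x \<cdot> r)"
    using assms r_ran by (simp add: act_smult act_fixes_ran_Zero)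
  then show ?thesis using smult_r_ran act_fixes_ran_Zero assms dom_carrier by simp
qed

section \<open>The group part and the tuples \<open>orbit x\<close>\<close>

lemma act_inv:
  assumes "g \<in> carrier G" "x \<in> D (Nz g)"
  shows "act (Nz g) x \<in> D (Nz (inv\<^bsub>G\<^esub> g))" "act (Nz (inv\<^bsub>G\<^esub> g)) (act (Nz g) x) = x"
  using assms dom_carrier[of "Nz g" x] by (simp_all add: act_dom_iff act_act dom_Nz_one act_Nz_one)

text \<open>The map \<open>\<alpha>\<^sub>g\<close> carries the ideal
  \<open>D g \<inter> D (ng)\<close> isomorphically onto \<open>D (inv g) \<inter> D n\<close>,
  hence identity to identity.\<close>

lemma act_smult_unit:
  assumes g: "g \<in> carrier G" and n: "n \<in> carrier G" and x: "x \<in> D (Nz g)"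
  shows "act (Nz g) x \<cdot> unit (Nz n) = act (Nz g) (x \<cdot> unit (Nz (n \<otimes>\<^bsub>G\<^esub> g)))"
proof -
  let ?a = "act (Nz g)" and ?e = "unit (Nz n)" and ?f = "unit (Nz (n \<otimes>\<^bsub>G\<^esub> g))"
  note [simp] = g n x
  have xX [simp]: "x \<in> carrier X" using dom_carrier[of "Nz g" x] by simp
  have [simp]: "?e \<in> carrier X" "?f \<in> carrier X" "unit (Nz g) \<in> carrier X" by (simp_all add: unit_closed)
  have ax [simp]: "?a x \<in> carrier X" by (simp add: act_closed)
  \<comment> \<open>The image of the identity of the first intersection.\<close>
  define q where "q = ?a (unit (Nz g) \<cdot> ?f)"
  have uf: "unit (Nz g) \<cdot> ?f \<in> D (Nz g)" "unit (Nz g) \<cdot> ?f \<in> D (Nz (n \<otimes>\<^bsub>G\<^esub> g))"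
    by (simp_all add: dom_smult unit_dom)
  have q: "q \<in> D (Nz n)" unfolding q_def using uf by (simp add: act_dom_iff)
  have qX: "q \<in> carrier X" using q dom_carrier[of "Nz n" q] by simp
  have a_q: "?a (y \<cdot> ?f) = ?a y \<cdot> q" if y: "y \<in> D (Nz g)" for y
  proof -
    have "y \<in> carrier X" using y dom_carrier[of "Nz g" y] by simp
    then have "y \<cdot> ?f = y \<cdot> (unit (Nz g) \<cdot> ?f)"
      using y by (simp add: smult_unit flip: X.smult_assoc)
    then show ?thesis using y uf by (simp add: act_smult q_def)
  qed
  \<comment> \<open>\<open>w\<close> lies in the second intersection, so it is the image of some
    \<open>v\<close> in the first. Hence \<open>w\<close> absorbs \<open>q\<close>, while
    \<open>q\<close> absorbs \<open>?e\<close>.\<close>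
  define w where "w = ?a x \<cdot> ?e"
  define v where "v = act (Nz (inv\<^bsub>G\<^esub> g)) w"
  have w: "w \<in> D (Nz n)" "w \<in> D (Nz (inv\<^bsub>G\<^esub> g))"
    by (simp_all add: w_def dom_smult unit_dom act_inv)
  have v: "v \<in> D (Nz g)" "?a v = w"
    using act_inv[of "inv\<^bsub>G\<^esub> g" w] w by (simp_all add: v_def)
  have "v \<in> D (Nz (n \<otimes>\<^bsub>G\<^esub> g))" using v w act_dom_iff[of "Nz g" "Nz n" v] by simp
  then have "w = w \<cdot> q" using a_q[of v] v by (simp add: smult_unit)
  also have "\<dots> = ?a x \<cdot> (?e \<cdot> q)" by (simp add: w_def X.smult_assoc qX)
  also have "?e \<cdot> q = q" using q qX by (simp add: unit_central smult_unit)
  also have "?a x \<cdot> q = ?a (x \<cdot> ?f)" by (simp add: a_q)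
  finally show ?thesis by (simp add: w_def)
qed

text \<open>The restriction makes equality in \<open>X\<^sup>G\<close> the equality of HOL
  functions.\<close>

definition orbit where "orbit x = (\<lambda>g\<in>carrier G. act (Nz g) (x \<cdot> unit (Nz g)))"

lemma fun_closed: "\<lbrakk>f \<in> carrier G \<rightarrow>\<^sub>E carrier X; g \<in> carrier G\<rbrakk> \<Longrightarrow> f g \<in> carrier X"
  by blast

lemma orbit_closed: "x \<in> carrier X \<Longrightarrow> orbit x \<in> carrier G \<rightarrow>\<^sub>E carrier X"
  by (auto simp: orbit_def act_closed smult_unit_dom)

lemma orbit_one: "x \<in> carrier X \<Longrightarrow> orbit x \<one>\<^bsub>G\<^esub> = x"
  by (simp add: orbit_def act_Nz_one smult_unit dom_Nz_one)

lemma orbit_smult: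
  assumes "x \<in> carrier X" "y \<in> carrier X"
  shows "orbit (x \<cdot> y) = (\<lambda>g\<in>carrier G. orbit x g \<cdot> orbit y g)"
  using assms by (auto simp: orbit_def smult_unit_hom act_smult smult_unit_dom)

text \<open>By \<open>act_smult_unit\<close> the idempotent moves inside as
  \<open>unit (Nz (g \<otimes> h))\<close>; the resulting element lies in both domains, so the
  composition law applies.\<close>

lemma orbit_act:
  assumes "h \<in> carrier G" "x \<in> D (Nz h)"
  shows "orbit (act (Nz h) x) = (\<lambda>g\<in>carrier G. orbit x (g \<otimes>\<^bsub>G\<^esub> h))"
  unfolding orbit_def
proof (rule restrict_ext)
  fix g assume g: "g \<in> carrier G"
  have "x \<in> carrier X" using assms dom_carrier[of "Nz h" x] by simp
  then have "x \<cdot> unit (Nz (g \<otimes>\<^bsub>G\<^esub> h)) \<in> D (Nz h)" "x \<cdot> unit (Nz (g \<otimes>\<^bsub>G\<^esub> h)) \<in> D (Nz (g \<otimes>\<^bsub>G\<^esub> h))"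
    using assms g by (simp_all add: dom_smult smult_unit_dom unit_closed)
  then show "act (Nz g) (act (Nz h) x \<cdot> unit (Nz g)) =
      (\<lambda>g\<in>carrier G. act (Nz g) (x \<cdot> unit (Nz g))) (g \<otimes>\<^bsub>G\<^esub> h)"
    using assms g by (simp add: act_smult_unit act_act)
qed

text \<open>The entry at the inverse of \<open>h\<close> exhibits \<open>x\<close> as a value of
  \<open>act (Nz (inv h))\<close>, which places it in \<open>D (Nz h)\<close>; the entry at the
  identity then gives \<open>y\<close>.\<close>

lemma orbit_shift_eqD:
  assumes h: "h \<in> carrier G" and x: "x \<in> carrier X" and y: "y \<in> carrier X"
    and eq: "(\<lambda>g\<in>carrier G. orbit x (g \<otimes>\<^bsub>G\<^esub> h)) = orbit y"
  shows "x \<in> D (Nz h)" "act (Nz h) x = y"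
proof -
  have at: "orbit x (g \<otimes>\<^bsub>G\<^esub> h) = orbit y g" if "g \<in> carrier G" for g
    using fun_cong[OF eq, of g] that by simp
  have "x = orbit y (inv\<^bsub>G\<^esub> h)" using at[of "inv\<^bsub>G\<^esub> h"] h x by (simp add: orbit_one)
  then have "x = act (Nz (inv\<^bsub>G\<^esub> h)) (y \<cdot> unit (Nz (inv\<^bsub>G\<^esub> h)))" using h by (simp add: orbit_def)
  then show dom: "x \<in> D (Nz h)"
    using act_inv(1)[of "inv\<^bsub>G\<^esub> h" "y \<cdot> unit (Nz (inv\<^bsub>G\<^esub> h))"] h y by (simp add: smult_unit_dom)
  have "y = orbit x h" using at[of "\<one>\<^bsub>G\<^esub>"] h y by (simp add: orbit_one)
  then show "act (Nz h) x = y" using dom h by (simp add: orbit_def smult_unit)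
qed

lemma orbit_smult_r: "x \<in> carrier X \<Longrightarrow> orbit (x \<cdot> r) = (\<lambda>g\<in>carrier G. x \<cdot> r)"
  using smult_r_ran by (auto simp: orbit_def act_fixes_ran_Zero smult_unit)

section \<open>The congruence refining the syntactic congruence of \<open>D Zero\<close>\<close>

text \<open>The first clause makes \<open>c \<cdot> r\<close> depend only on the class of
  \<open>c\<close>. Contexts from \<open>X\<close> suffice because \<open>X\<close> has an
  identity.\<close>

definition congr (infix "\<sim>" 50) where
  "x \<sim> y \<longleftrightarrow> x \<cdot> r = y \<cdot> r \<and>
     (\<forall>a\<in>carrier X. \<forall>b\<in>carrier X. a \<cdot> x \<cdot> b \<in> D Zero \<longleftrightarrow> a \<cdot> y \<cdot> b \<in> D Zero)"

lemma congr_smult: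
  assumes X: "x \<in> carrier X" "x' \<in> carrier X" "y \<in> carrier X" "y' \<in> carrier X"
    and c: "x \<sim> x'" "y \<sim> y'"
  shows "x \<cdot> y \<sim> x' \<cdot> y'"
proof -
  have "a \<cdot> (x \<cdot> y) \<cdot> b \<in> D Zero \<longleftrightarrow> a \<cdot> (x' \<cdot> y') \<cdot> b \<in> D Zero"
    if ab: "a \<in> carrier X" "b \<in> carrier X" for a b
  proof -
    note [simp] = X ab X.smult_closed
    \<comment> \<open>One factor is replaced at a time, the other being absorbed into the
      context.\<close>
    have "a \<cdot> (x \<cdot> y) \<cdot> b \<in> D Zero \<longleftrightarrow> a \<cdot> x \<cdot> (y \<cdot> b) \<in> D Zero" by (simp add: X.smult_assoc)
    also have "\<dots> \<longleftrightarrow> a \<cdot> x' \<cdot> (y \<cdot> b) \<in> D Zero" using c by (simp add: congr_def)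
    also have "\<dots> \<longleftrightarrow> a \<cdot> x' \<cdot> y \<cdot> b \<in> D Zero" by (simp add: X.smult_assoc)
    also have "\<dots> \<longleftrightarrow> a \<cdot> x' \<cdot> y' \<cdot> b \<in> D Zero" using c by (simp add: congr_def)
    finally show ?thesis by (simp add: X.smult_assoc)
  qed
  moreover have "(x \<cdot> y) \<cdot> r = (x' \<cdot> y') \<cdot> r"
    using c X by (simp add: smult_r_hom congr_def)
  ultimately show ?thesis by (simp add: congr_def)
qed

lemma congr_dom_Zero:
  assumes "x \<in> carrier X" "y \<in> carrier X" "x \<sim> y" "y \<in> D Zero"
  shows "x \<in> D Zero"
proof -
  have one: "Nz \<one>\<^bsub>G\<^esub> \<in> carrier M" by simp
  \<comment> \<open>The identity of \<open>X\<close> on both sides is the trivial context.\<close>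
  let ?e = "unit (Nz \<one>\<^bsub>G\<^esub>)"
  have "?e \<cdot> x \<cdot> ?e = x" "?e \<cdot> y \<cdot> ?e = y"
    using assms one by (simp_all add: unit_central smult_unit dom_Nz_one)
  moreover have "?e \<cdot> x \<cdot> ?e \<in> D Zero \<longleftrightarrow> ?e \<cdot> y \<cdot> ?e \<in> D Zero"
    using assms(3) unit_closed[OF one] by (simp add: congr_def)
  ultimately show ?thesis using assms(4) by simp
qed

text \<open>Since \<open>D Zero\<close> is an ideal, every context keeps both elements inside
  it.\<close>

lemma congr_smult_r:
  assumes "x \<in> D Zero"
  shows "x \<cdot> r \<sim> x"
proof -
  have x: "x \<in> carrier X" using assms dom_carrier[of Zero x] by simp
  have "x \<cdot> r \<in> D Zero" using assms by (simp add: dom_smult)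
  then show ?thesis
    using assms x by (auto simp: congr_def dom_smult smult_r_ran ran_Zero_smult_r)
qed

text \<open>The quotient \<open>X/\<sim>\<close> is realized on chosen representatives.\<close>

definition rep where "rep x = (SOME y. y \<in> carrier X \<and> x \<sim> y)"

lemma
  assumes "x \<in> carrier X"
  shows rep_closed: "rep x \<in> carrier X" and congr_rep: "x \<sim> rep x"
proof -
  have "x \<in> carrier X \<and> x \<sim> x" using assms by (simp add: congr_def)
  from someI[of "\<lambda>y. y \<in> carrier X \<and> x \<sim> y", OF this]
  show "rep x \<in> carrier X" "x \<sim> rep x" by (simp_all add: rep_def)
qed

lemma rep_eqI: "x \<sim> y \<Longrightarrow> rep x = rep y"
  by (simp add: rep_def congr_def)

lemma rep_eqD: "\<lbrakk>x \<in> carrier X; y \<in> carrier X; rep x = rep y\<rbrakk> \<Longrightarrow> x \<sim> y"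
  using congr_rep[of x] congr_rep[of y] by (simp add: congr_def)

lemma rep_smult_r: "x \<in> carrier X \<Longrightarrow> rep x \<cdot> r = x \<cdot> r"
  using congr_rep by (simp add: congr_def)

lemma rep_smult: "\<lbrakk>x \<in> carrier X; y \<in> carrier X\<rbrakk> \<Longrightarrow> rep (rep x \<cdot> rep y) = rep (x \<cdot> y)"
  by (metis rep_eqI congr_rep congr_smult rep_closed)

section \<open>The global action on \<open>X\<^sup>G \<times> X/\<sim>\<close>\<close>

definition glob where
  "glob = \<lparr>carrier = (carrier G \<rightarrow>\<^sub>E carrier X) \<times> rep ` carrier X,
     smult = \<lambda>(f, c) (f', c'). (\<lambda>g\<in>carrier G. f g \<cdot> f' g, rep (c \<cdot> c'))\<rparr>"

text \<open>Right translation of the argument gives a left action. The constant tuple for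
  \<open>Zero\<close> matches \<open>orbit (x \<cdot> r)\<close>, as each
  \<open>\<alpha>\<^sub>g\<close> fixes \<open>x \<cdot> r\<close>.\<close>

fun shift where
  "shift (Nz h) (f, c) = (\<lambda>g\<in>carrier G. f (g \<otimes>\<^bsub>G\<^esub> h), c)"
| "shift Zero (f, c) = (\<lambda>g\<in>carrier G. c \<cdot> r, c)"

definition glob_act where
  "glob_act m = (\<lambda>p. if p \<in> carrier glob then Some (shift m p) else None)"

definition emb where "emb x = (orbit x, rep x)"

lemma carrier_glob: "carrier glob = (carrier G \<rightarrow>\<^sub>E carrier X) \<times> rep ` carrier X"
  and smult_glob: "(f, c) \<cdot>\<^bsub>glob\<^esub> (f', c') = (\<lambda>g\<in>carrier G. f g \<cdot> f' g, rep (c \<cdot> c'))"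
  by (simp_all add: glob_def)

lemma emb_closed: "x \<in> carrier X \<Longrightarrow> emb x \<in> carrier glob"
  using orbit_closed by (simp add: emb_def carrier_glob)

lemma dom_glob_act: "dom (glob_act m) = carrier glob"
  by (auto simp: glob_act_def split: if_splits)

lemma sgroup_glob: "sgroup glob"
proof
  fix p q s assume "p \<in> carrier glob" "q \<in> carrier glob" "s \<in> carrier glob"
  then obtain f x f' y f'' z where *:
    "p = (f, rep x)" "q = (f', rep y)" "s = (f'', rep z)"
    "x \<in> carrier X" "y \<in> carrier X" "z \<in> carrier X"
    "f \<in> carrier G \<rightarrow>\<^sub>E carrier X" "f' \<in> carrier G \<rightarrow>\<^sub>E carrier X" "f'' \<in> carrier G \<rightarrow>\<^sub>E carrier X"
    by (auto simp: carrier_glob)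
  then show "p \<cdot>\<^bsub>glob\<^esub> q \<cdot>\<^bsub>glob\<^esub> s = p \<cdot>\<^bsub>glob\<^esub> (q \<cdot>\<^bsub>glob\<^esub> s)"
    by (auto simp: smult_glob rep_smult X.smult_closed X.smult_assoc fun_closed intro!: restrict_ext)
  from * show "p \<cdot>\<^bsub>glob\<^esub> q \<in> carrier glob"
    by (auto simp: smult_glob rep_smult carrier_glob X.smult_closed fun_closed)
qed

lemma shift_closed: "m \<in> carrier M \<Longrightarrow> p \<in> carrier glob \<Longrightarrow> shift m p \<in> carrier glob"
  by (auto simp: carrier_M carrier_glob X.smult_closed rep_closed fun_closed)

lemma shift_shift:
  "\<lbrakk>m \<in> carrier M; n \<in> carrier M; p \<in> carrier glob\<rbrakk> \<Longrightarrow> shift n (shift m p) = shift (n \<otimes>\<^bsub>M\<^esub> m) p"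
  by (cases p; cases m; cases n) (auto simp: carrier_M G.m_assoc intro!: restrict_ext)

lemma shift_one: "p \<in> carrier glob \<Longrightarrow> shift (Nz \<one>\<^bsub>G\<^esub>) p = p"
  by (auto simp: carrier_glob PiE_def extensional_def intro!: ext)

text \<open>For \<open>Zero\<close> the point is that passing to representatives does not change
  multiplication by \<open>r\<close>, which is itself a homomorphism.\<close>

lemma shift_smult:
  assumes "m \<in> carrier M" "p \<in> carrier glob" "q \<in> carrier glob"
  shows "shift m (p \<cdot>\<^bsub>glob\<^esub> q) = shift m p \<cdot>\<^bsub>glob\<^esub> shift m q"
  using assms
  by (auto simp: carrier_M carrier_glob smult_glob rep_smult rep_smult_r smult_r_hom X.smult_closed
      intro!: restrict_ext)

lemma global_action_glob: "global_action M glob glob_act"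
proof -
  interpret Y: sgroup glob by (rule sgroup_glob)
  show ?thesis
  proof
    fix m assume m: "m \<in> carrier M"
    show "ran (glob_act m) \<subseteq> carrier glob"
      using shift_closed[OF m] by (auto simp: glob_act_def ran_def split: if_splits) metis
    show "subsemigroup (dom (glob_act m)) glob"
      by (simp add: subsemigroup_def dom_glob_act Y.smult_closed)
    show "the (glob_act m (x \<cdot>\<^bsub>glob\<^esub> y)) = the (glob_act m x) \<cdot>\<^bsub>glob\<^esub> the (glob_act m y)"
      if "x \<in> dom (glob_act m)" "y \<in> dom (glob_act m)" for x y
      using that m by (simp add: dom_glob_act, simp add: glob_act_def Y.smult_closed shift_smult)
    fix n assume n: "n \<in> carrier M"
    show "pre_image (glob_act m) (dom (glob_act n)) = dom (glob_act (n \<otimes>\<^bsub>M\<^esub> m)) \<inter> dom (glob_act m)"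
      using m by (auto simp: pre_image_def dom_glob_act, simp add: glob_act_def shift_closed)
    show "the (glob_act n (the (glob_act m x))) = the (glob_act (n \<otimes>\<^bsub>M\<^esub> m) x)"
      if "x \<in> pre_image (glob_act m) (dom (glob_act n))" for x
      using that m n
      by (simp add: pre_image_def dom_glob_act, simp add: glob_act_def shift_closed shift_shift)
  next
    show "the (glob_act \<one>\<^bsub>M\<^esub> x) = x" if "x \<in> carrier glob" for x
      using that by (simp add: glob_act_def one_M shift_one)
  qed (simp_all add: dom_glob_act)
qed

section \<open>Sufficiency of (LC2')\<close>

lemma rep_act:
  assumes LC: "\<And>g y a b. \<lbrakk>g \<in> carrier G; y \<in> D (Nz g); a \<in> carrier X; b \<in> carrier X;
      a \<cdot> y \<cdot> b \<in> D Zero\<rbrakk> \<Longrightarrow> a \<cdot> act (Nz g) y \<cdot> b \<in> D Zero"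
    and m: "m \<in> carrier M" and y: "y \<in> D m"
  shows "rep (act m y) = rep y"
proof (cases m)
  case Zero
  then show ?thesis using y by (simp add: act_Zero_eq rep_eqI congr_smult_r)
next
  case (Nz g)
  with m y have g: "g \<in> carrier G" and y: "y \<in> D (Nz g)" by auto
  \<comment> \<open>The converse implication is the same condition for the inverse of
    \<open>g\<close>, which sends \<open>act (Nz g) y\<close> back to \<open>y\<close>.\<close>
  have "a \<cdot> y \<cdot> b \<in> D Zero" if "a \<in> carrier X" "b \<in> carrier X" "a \<cdot> act (Nz g) y \<cdot> b \<in> D Zero" for a b
    using LC[of "inv\<^bsub>G\<^esub> g" "act (Nz g) y" a b] that g y by (simp add: act_inv)
  then have "a \<cdot> act (Nz g) y \<cdot> b \<in> D Zero \<longleftrightarrow> a \<cdot> y \<cdot> b \<in> D Zero"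
    if "a \<in> carrier X" "b \<in> carrier X" for a b
    using LC[OF g y] that by meson
  then have "act (Nz g) y \<sim> y"
    using g y by (simp add: congr_def act_smult_r)
  then show ?thesis using Nz by (simp add: rep_eqI)
qed

lemma is_globalization_glob:
  assumes LC: "\<And>g y a b. \<lbrakk>g \<in> carrier G; y \<in> D (Nz g); a \<in> carrier X; b \<in> carrier X;
      a \<cdot> y \<cdot> b \<in> D Zero\<rbrakk> \<Longrightarrow> a \<cdot> act (Nz g) y \<cdot> b \<in> D Zero"
  shows "is_globalization M X \<alpha> glob glob_act emb"
proof -
  have "emb \<in> sg_hom X glob"
    by (auto simp: sg_hom_def emb_closed)
      (simp add: emb_def smult_glob orbit_smult rep_smult)
  moreover have "the (glob_act m (emb x)) = emb (the (\<alpha> m x))" if "m \<in> carrier M" "x \<in> D m" for m x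
  proof -
    have x: "x \<in> carrier X" using that dom_carrier by blast
    \<comment> \<open>\<open>shift\<close> leaves the second component alone, so
      \<open>rep (act m x) = rep x\<close> is exactly what that component requires.\<close>
    have "shift m (emb x) = emb (act m x)"
    proof (cases m)
      case Zero
      then show ?thesis using that x rep_act[OF LC that]
        by (simp add: emb_def act_Zero_eq orbit_smult_r rep_smult_r)
    next
      case (Nz h)
      then show ?thesis using that x rep_act[OF LC that]
        by (simp add: emb_def orbit_act)
    qed
    then show ?thesis using x by (simp add: glob_act_def emb_closed act_def)
  qed
  moreover have "x \<in> D m \<and> the (\<alpha> m x) = y"
    if "x \<in> carrier X" "y \<in> carrier X" "m \<in> carrier M" "the (glob_act m (emb x)) = emb y" for x y m
  proof -
    have eq: "shift m (emb x) = emb y" using that by (simp add: glob_act_def emb_closed)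
    show ?thesis
    proof (cases m)
      case Zero
      then have "(\<lambda>g\<in>carrier G. x \<cdot> r) = orbit y" and rep: "rep x = rep y"
        using eq that by (simp_all add: emb_def rep_smult_r)
      \<comment> \<open>The entry at the identity yields \<open>y = x \<cdot> r\<close>, a point of
        \<open>D Zero\<close>; the second component carries this membership over to
        \<open>x\<close>.\<close>
      from fun_cong[OF this(1), of "\<one>\<^bsub>G\<^esub>"] have y: "y = x \<cdot> r" using that by (simp add: orbit_one)
      then have "y \<in> D Zero" using that smult_r_ran act_fixes_ran_Zero by simp
      then have "x \<in> D Zero" using that rep by (meson congr_dom_Zero rep_eqD)
      then show ?thesis using Zero y by (simp add: act_Zero_eq flip: act_def)
    next
      case (Nz h)
      then show ?thesis using eq that orbit_shift_eqD[of h x y] by (simp add: emb_def act_def)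
    qed
  qed
  ultimately show ?thesis
    unfolding is_globalization_def action_morphism_def using global_action_glob by blast
qed

text \<open>As \<open>X\<close> has an identity element, the adjoined one contributes nothing.\<close>

lemma LC2'_iff:
  "LC2' G X \<alpha> \<longleftrightarrow> (\<forall>g\<in>carrier G. \<forall>y\<in>D (Nz g). \<forall>a\<in>carrier X. \<forall>b\<in>carrier X.
     a \<cdot> y \<cdot> b \<in> D Zero \<longrightarrow> a \<cdot> act (Nz g) y \<cdot> b \<in> D Zero)" (is "_ \<longleftrightarrow> ?R")
proof
  assume LC: "LC2' G X \<alpha>"
  show ?R
  proof (intro ballI impI)
    fix g y a b assume "g \<in> carrier G" "y \<in> D (Nz g)" "a \<in> carrier X" "b \<in> carrier X"
      "a \<cdot> y \<cdot> b \<in> D Zero"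
    then show "a \<cdot> act (Nz g) y \<cdot> b \<in> D Zero"
      using LC[unfolded LC2'_def, rule_format, of g y "In a" "In b"]
      by (auto simp: adjoin_one_def act_def)
  qed
next
  assume R: ?R
  define e where "e = unit (Nz \<one>\<^bsub>G\<^esub>)"
  have e: "e \<in> carrier X" "\<And>x. x \<in> carrier X \<Longrightarrow> x \<cdot> e = x" "\<And>x. x \<in> carrier X \<Longrightarrow> e \<cdot> x = x"
    by (simp_all add: e_def unit_closed unit_central smult_unit dom_Nz_one)
  have *: "\<exists>a'\<in>carrier X. \<forall>w\<in>carrier X. a \<cdot>\<^bsub>adjoin_one X\<^esub> In w = In (a' \<cdot> w) \<and>
      In w \<cdot>\<^bsub>adjoin_one X\<^esub> a = In (w \<cdot> a')" if "a \<in> carrier (adjoin_one X)" for a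
  proof (cases a)
    case One
    then show ?thesis using e by (intro bexI[of _ e]) (simp_all add: adjoin_one_def)
  next
    case (In x)
    then show ?thesis using that by (intro bexI[of _ x]) (auto simp: adjoin_one_def)
  qed
  show "LC2' G X \<alpha>"
    unfolding LC2'_def
  proof (intro ballI impI)
    fix g y a b
    assume g: "g \<in> carrier G" and y: "y \<in> D (Nz g)"
      and ab: "a \<in> carrier (adjoin_one X)" "b \<in> carrier (adjoin_one X)"
      and dom: "a \<cdot>\<^bsub>adjoin_one X\<^esub> In y \<cdot>\<^bsub>adjoin_one X\<^esub> b \<in> In ` D Zero"
    obtain a' where a': "a' \<in> carrier X" "\<And>w. w \<in> carrier X \<Longrightarrow> a \<cdot>\<^bsub>adjoin_one X\<^esub> In w = In (a' \<cdot> w)"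
      using *[OF ab(1)] by blast
    obtain b' where b': "b' \<in> carrier X" "\<And>w. w \<in> carrier X \<Longrightarrow> In w \<cdot>\<^bsub>adjoin_one X\<^esub> b = In (w \<cdot> b')"
      using *[OF ab(2)] by blast
    have yX: "y \<in> carrier X" "act (Nz g) y \<in> carrier X"
      using g y dom_carrier[of "Nz g" y] by (simp_all add: act_closed)
    have prod: "a \<cdot>\<^bsub>adjoin_one X\<^esub> In w \<cdot>\<^bsub>adjoin_one X\<^esub> b = In (a' \<cdot> w \<cdot> b')" if "w \<in> carrier X" for w
      using that a' b' by (simp add: X.smult_closed)
    have "a' \<cdot> y \<cdot> b' \<in> D Zero" using dom prod[OF yX(1)] by auto
    then have "a' \<cdot> act (Nz g) y \<cdot> b' \<in> D Zero" using R g y a'(1) b'(1) by blast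
    then show "a \<cdot>\<^bsub>adjoin_one X\<^esub> In (the (\<alpha> (Nz g) y)) \<cdot>\<^bsub>adjoin_one X\<^esub> b \<in> In ` D Zero"
      using prod[OF yX(2)] by (simp add: act_def)
  qed
qed

section \<open>Necessity of (LC2')\<close>

lemma globalization_LC:
  assumes glob: "is_globalization M X \<alpha> Y \<beta> \<iota>"
    and g: "g \<in> carrier G" and y: "y \<in> D (Nz g)" and ab: "a \<in> carrier X" "b \<in> carrier X"
    and dom: "a \<cdot> y \<cdot> b \<in> D Zero"
  shows "a \<cdot> act (Nz g) y \<cdot> b \<in> D Zero"
proof -
  interpret Y: global_action M Y \<beta> using glob by (simp add: is_globalization_def)
  have \<iota>: "\<And>x. x \<in> carrier X \<Longrightarrow> \<iota> x \<in> carrier Y"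
    "\<And>x z. \<lbrakk>x \<in> carrier X; z \<in> carrier X\<rbrakk> \<Longrightarrow> \<iota> (x \<cdot> z) = \<iota> x \<cdot>\<^bsub>Y\<^esub> \<iota> z"
    "\<And>m x. \<lbrakk>m \<in> carrier M; x \<in> D m\<rbrakk> \<Longrightarrow> the (\<beta> m (\<iota> x)) = \<iota> (act m x)"
    using glob by (auto simp: is_globalization_def action_morphism_def sg_hom_def act_def)
  have yX: "y \<in> carrier X" "act (Nz g) y \<in> carrier X"
    using g y dom_carrier[of "Nz g" y] by (simp_all add: act_closed)
  define f where "f x = the (\<beta> Zero (\<iota> x))" for x
  have f_smult: "f (x \<cdot> z) = f x \<cdot>\<^bsub>Y\<^esub> f z" if "x \<in> carrier X" "z \<in> carrier X" for x z
    using that by (simp add: f_def \<iota> Y.act_hom Y.dom_global)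
  \<comment> \<open>This is \<open>\<beta>\<^sub>0\<beta>\<^sub>g = \<beta>\<^sub>0\<close>
    evaluated at \<open>\<iota> y\<close>.\<close>
  have "f (act (Nz g) y) = f y"
    using g y yX Y.global_act_mult[of "Nz g" Zero "\<iota> y"] by (simp add: f_def \<iota>)
  then have "f (a \<cdot> act (Nz g) y \<cdot> b) = f (a \<cdot> y \<cdot> b)"
    using ab yX by (simp add: f_smult X.smult_closed)
  also have "\<dots> = \<iota> (act Zero (a \<cdot> y \<cdot> b))" using dom by (simp add: f_def \<iota>)
  \<comment> \<open>The value of \<open>\<beta>\<^sub>0\<close> lies in the image of
    \<open>\<iota>\<close>, so the defining condition of a globalization applies at
    \<open>Zero\<close>.\<close>
  finally show ?thesis
    using glob ab yX dom unfolding is_globalization_def f_def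
    by (metis M_simps(1) X.smult_closed act_closed)
qed

end

theorem theorem4p10:
  fixes G :: "('g, 'c) monoid_scheme"
    and X :: "('x, 'd) sgrp_scheme"
    and \<alpha> :: "'g with_zero \<Rightarrow> 'x \<rightharpoonup> 'x"
  assumes "group G"
    and "strong_partial_action (adjoin_zero G) X \<alpha>"
    and "\<And>m. m \<in> carrier (adjoin_zero G) \<Longrightarrow> unital_ideal (dom (\<alpha> m)) X"
    and "\<And>m. m \<in> carrier (adjoin_zero G) \<Longrightarrow> unital_ideal (ran (\<alpha> m)) X"
  shows "globalizable (adjoin_zero G) X \<alpha> \<longleftrightarrow> LC2' G X \<alpha>"
proof -
  have "Zero \<in> carrier (adjoin_zero G)" by (simp add: adjoin_zero_def)
  from assms(4)[OF this] have "sg_ideal (ran (\<alpha> Zero)) X" by (simp add: unital_ideal_def)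
  with assms interpret unital_g0_action X G \<alpha>
    by (simp add: unital_g0_action_def unital_g0_action_axioms_def)
  show ?thesis
  proof
    assume "globalizable M X \<alpha>"
    then show "LC2' G X \<alpha>"
      unfolding globalizable_def LC2'_iff using globalization_LC by blast
  next
    assume "LC2' G X \<alpha>"
    then have "is_globalization M X \<alpha> glob glob_act emb"
      unfolding LC2'_iff by (intro is_globalization_glob) blast
    \<comment> \<open>\<open>glob\<close> has pairs as elements; \<open>globalizableI\<close>
      transfers it to the type of words.\<close>
    then show "globalizable M X \<alpha>"
      by (rule globalizableI[OF assms(2)])
  qed
qed

end
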